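(* Let $C\subseteq R_n$ be a nonzero skew cyclic code of length $n$ over $R=\mathbb{F}_p+u\mathbb{F}_p$. (1) If $C=\langle u\overline{a(x)}\rangle$, where $\overline{a(x)}\in\mathbb{F}_p[x]$, $u\overline{a(x)}$ is a polynomial of minimal degree $r$ in $C$, and $x^n-1=\overline{b(x)}\,\overline{a(x)}$ in $\mathbb{F}_p[x]$ for some $\overline{b(x)}\in\mathbb{F}_p[x]$, then $$\beta=\{u\overline{a(x)},\,x\ast u\overline{a(x)},\ldots,x^{n-r-1}\ast u\overline{a(x)}\}$$ forms a minimal generating set for $C$, and $|C|=p^{n-r}$. (2) If $C=\langle g(x)\rangle$, where $g(x)$ is a polynomial of minimal degree $r$ in $C$ and $x^n-1=k(x)\ast g(x)$ in $R_n$ for some $k(x)$, then $$\beta=\{g(x),\,x\ast g(x),\ldots,x^{n-r-1}\ast g(x)\}$$ forms a minimal generating set for $C$, and $|C|=(p^2)^{n-r}$. (3) Suppose $C=\langle g(x)+up(x),\,a(x)\rangle=\langle g(x)+up(x),\,u\overline{a(x)}\rangle$, where $p(x),\overline{a(x)}\in\mathbb{F}_p[x]$, $a(x)=u\overline{a(x)}$ is a polynomial of minimal degree $t$ in $C$ which is not monic, $g(x)$ is a monic polynomial in $C$ of minimal degree $r$ among all monic polynomials in $C$, $x^n-1=k(x)\ast g(x)$ in $R[x;\theta]$ for some $k(x)\in R[x;\theta]$, $x^n-1=\overline{b(x)}\,\overline{a(x)}$ in $\mathbb{F}_p[x]$ for some $\overline{b(x)}\in\mathbb{F}_p[x]$,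 $\overline{a(x)}$ divides $g(x)$ modulo $u$ (i.e. writing $g=g_1+ug_2$ with $g_1,g_2\in\mathbb{F}_p[x]$, $\overline{a(x)}\mid g_1(x)$ in $\mathbb{F}_p[x]$), and $\frac{x^n-1}{g}\ast up(x)\in\langle u\overline{a(x)}\rangle$, where $\frac{x^n-1}{g}$ denotes the left cofactor $k(x)$ with $k(x)\ast g(x)=x^n-1$. Then $$\beta=\{g(x)+up(x),\,x\ast(g(x)+up(x)),\ldots,x^{n-r-1}\ast(g(x)+up(x)),\ u\overline{a(x)},\,x\ast u\overline{a(x)},\ldots,x^{r-t-1}\ast u\overline{a(x)}\}$$ forms a minimal generating set for $C$, and $|C|=(p^2)^{n-r}p^{r-t}$.
   Context: Let $p$ be an odd prime, $R=\mathbb{F}_p+u\mathbb{F}_p=\mathbb{F}_p[u]/\langle u^2\rangle$, and let $\theta$ be a ring automorphism of $R$ of order $e>1$. The skew polynomial ring $R[x;\theta]$ is the set of polynomials $a_0+a_1x+\cdots+a_mx^m$ with $a_i\in R$ (coefficients on the left), with usual addition and with multiplication $\ast$ determined by distributivity and $(ax^i)\ast(bx^j)=a\theta^i(b)x^{i+j}$. The ordinary polynomial ring $\mathbb{F}_p[x]$ is a subring, and each element of $R[x;\theta]$ is uniquely $f_1+uf_2$ with $f_1,f_2\in\mathbb{F}_p[x]$. Let $n\ge 1$ (no relation between $n$ and $e$ is assumed) and let $R_n=R[x;\theta]/\langle x^n-1\rangle$, where $\langle x^n-1\rangle=R[x;\theta]\ast(x^n-1)$ is the left ideal generated by $x^n-1$;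 $R_n$ is a left $R[x;\theta]$-module via $r(x)(f(x)+\langle x^n-1\rangle)=r(x)\ast f(x)+\langle x^n-1\rangle$. Elements of $R_n$ are identified with their unique representatives of degree less than $n$, and degree, leading coefficient and "monic" (leading coefficient $1$) for elements of $R_n$ refer to these representatives; "a polynomial of minimal degree in $C$" means a nonzero element of $C$ of minimal degree among the nonzero elements of $C$. A skew cyclic code of length $n$ over $R$ is a left $R[x;\theta]$-submodule $C$ of $R_n$. $\langle f_1,\dots,f_m\rangle$ denotes the left $R[x;\theta]$-submodule of $R_n$ generated by $f_1,\dots,f_m$. A minimal generating set of $C$ is a subset that spans $C$ as a left $R$-module and in which no element is an $R$-linear combination of the others.
   Formalization: In (2) the equation x^n-1=k(x)*g(x) is required in R[x;θ] instead of in R_n, where x^n-1 is zero, so that k=0 would satisfy it and the claim would fail (g=u gives |C|=p^n, not p^{2n}). *)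

theory Defs
  imports
    "HOL-Computational_Algebra.Polynomial"
    "Berlekamp_Zassenhaus.Finite_Field"
begin

section \<open>The ring \<open>A + uA\<close> with \<open>u\<^sup>2 = 0\<close>\<close>

text \<open>\<open>Dual a b\<close> stands for \<open>a + u b\<close>.\<close>

datatype 'a dual = Dual (fst_part: 'a) (snd_part: 'a)

instantiation dual :: (comm_ring_1) comm_ring_1
begin

definition "0 = Dual 0 0"
definition "1 = Dual 1 0"
definition "r + s = Dual (fst_part r + fst_part s) (snd_part r + snd_part s)"
definition "r - s = Dual (fst_part r - fst_part s) (snd_part r - snd_part s)"
definition "- r = Dual (- fst_part r) (- snd_part r)"
definition "r * s = Dual (fst_part r * fst_part s) (fst_part r * snd_part s + snd_part r * fst_part s)"

instance
  by standard
    (auto simp: zero_dual_def one_dual_def plus_dual_def minus_dual_def uminus_dual_def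
      times_dual_def algebra_simps)

end

lemmas dual_ring_defs = zero_dual_def one_dual_def plus_dual_def minus_dual_def
  uminus_dual_def times_dual_def

definition u_elem :: "'a::comm_ring_1 dual" where
  "u_elem = Dual 0 1"

lemma Dual_eq: "Dual a b = Dual a 0 + u_elem * Dual b 0"
  by (simp add: dual_ring_defs u_elem_def)

text \<open>The next four facts identify \<open>'a dual\<close> with the quotient of \<open>'a[u]\<close> by the ideal
  generated by \<open>u\<^sup>2\<close>.\<close>

definition dual_of_poly :: "'a::comm_ring_1 poly \<Rightarrow> 'a dual" where
  "dual_of_poly f = Dual (coeff f 0) (coeff f 1)"

lemma dual_of_poly_hom: "comm_ring_hom (dual_of_poly :: 'a::comm_ring_1 poly \<Rightarrow> 'a dual)"
  by unfold_locales
    (auto simp: dual_of_poly_def dual_ring_defs coeff_mult_0 coeff_mult atMost_Suc algebra_simps)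

lemma dual_of_poly_surj: "surj (dual_of_poly :: 'a::comm_ring_1 poly \<Rightarrow> 'a dual)"
proof (rule surjI)
  show "dual_of_poly [:fst_part r, snd_part r:] = r" for r :: "'a dual"
    by (simp add: dual_of_poly_def)
qed

lemma dual_of_poly_X: "dual_of_poly [:0, 1:] = u_elem"
  by (simp add: dual_of_poly_def u_elem_def)

lemma dual_of_poly_kernel: "dual_of_poly f = 0 \<longleftrightarrow> [:0, 1:] ^ 2 dvd f"
proof -
  have "[:0, 1:] ^ 2 = monom (1::'a) 2"
    by (simp add: numeral_2_eq_2 monom_Suc monom_0 power2_eq_square)
  moreover have "dual_of_poly f = 0 \<longleftrightarrow> (\<forall>k<2. coeff f k = 0)"
    by (auto simp: dual_of_poly_def zero_dual_def less_Suc_eq numeral_2_eq_2)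
  ultimately show ?thesis
    by (simp add: monom_1_dvd_iff')
qed

section \<open>Skew polynomials\<close>

text \<open>A skew polynomial is represented by its (left) coefficients, that is, by an element of the
  type \<open>'r poly\<close>, whose additive structure and scalar multiplication \<open>smult\<close> are those of the skew
  polynomial ring. The product is \<open>skew_mult \<theta>\<close>; the commutative multiplication of the type
  \<open>'r poly\<close> is a different operation, used over \<open>R\<close> only as a proof device.\<close>

definition skew_mult :: "('r \<Rightarrow> 'r) \<Rightarrow> 'r::comm_ring_1 poly \<Rightarrow> 'r poly \<Rightarrow> 'r poly" where
  "skew_mult \<theta> f g =
    (\<Sum>i\<le>degree f. \<Sum>j\<le>degree g. monom (coeff f i * (\<theta> ^^ i) (coeff g j)) (i + j))"

definition is_aut_order :: "('r \<Rightarrow> 'r) \<Rightarrow> nat \<Rightarrow> bool" where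
  "is_aut_order \<theta> e \<longleftrightarrow> is_arg_min id (\<lambda>k. 0 < k \<and> \<theta> ^^ k = id) e"

definition base_poly :: "'a::comm_ring_1 poly \<Rightarrow> 'a dual poly" where
  "base_poly f = map_poly (\<lambda>a. Dual a 0) f"

abbreviation u_poly :: "'a::comm_ring_1 poly \<Rightarrow> 'a dual poly" where
  "u_poly f \<equiv> smult u_elem (base_poly f)"

abbreviation xn1 :: "nat \<Rightarrow> 'r::comm_ring_1 poly" where
  "xn1 n \<equiv> monom 1 n - 1"

section \<open>The module \<open>R\<^sub>n\<close> and skew cyclic codes\<close>

definition xn1_ideal :: "('r \<Rightarrow> 'r) \<Rightarrow> nat \<Rightarrow> 'r::comm_ring_1 poly set" where
  "xn1_ideal \<theta> n = range (\<lambda>q. skew_mult \<theta> q (xn1 n))"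

text \<open>Elements of \<open>R\<^sub>n\<close> are the polynomials of degree less than \<open>n\<close>; \<open>residue \<theta> n f\<close> is the
  representative of the coset of \<open>f\<close> (see \<open>residue_unique\<close> below), and \<open>skew_act\<close> is the action
  \<open>r (f + I) = r * f + I\<close> on representatives (see \<open>skew_act_residue\<close> below).\<close>

definition Rn :: "nat \<Rightarrow> 'r::comm_ring_1 poly set" where
  "Rn n = {f. degree f < n}"

definition residue :: "('r \<Rightarrow> 'r) \<Rightarrow> nat \<Rightarrow> 'r::comm_ring_1 poly \<Rightarrow> 'r poly" where
  "residue \<theta> n f = (THE r. r \<in> Rn n \<and> f - r \<in> xn1_ideal \<theta> n)"

definition skew_act :: "('r \<Rightarrow> 'r) \<Rightarrow> nat \<Rightarrow> 'r::comm_ring_1 poly \<Rightarrow> 'r poly \<Rightarrow> 'r poly" where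
  "skew_act \<theta> n r f = residue \<theta> n (skew_mult \<theta> r f)"

definition skew_cyclic_code :: "('r \<Rightarrow> 'r) \<Rightarrow> nat \<Rightarrow> 'r::comm_ring_1 poly set \<Rightarrow> bool" where
  "skew_cyclic_code \<theta> n C \<longleftrightarrow>
     C \<subseteq> Rn n \<and> 0 \<in> C \<and> (\<forall>f\<in>C. \<forall>g\<in>C. f + g \<in> C) \<and> (\<forall>r. \<forall>f\<in>C. skew_act \<theta> n r f \<in> C)"

abbreviation generated_code :: "('r \<Rightarrow> 'r) \<Rightarrow> nat \<Rightarrow> 'r::comm_ring_1 poly set \<Rightarrow> 'r poly set" where
  "generated_code \<theta> n S \<equiv> skew_cyclic_code \<theta> n hull S"

definition minimal_degree_in :: "'r::comm_ring_1 poly set \<Rightarrow> 'r poly \<Rightarrow> bool" where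
  "minimal_degree_in C f \<longleftrightarrow> is_arg_min degree (\<lambda>h. h \<in> C \<and> h \<noteq> 0) f"

definition minimal_degree_monic_in :: "'r::comm_ring_1 poly set \<Rightarrow> 'r poly \<Rightarrow> bool" where
  "minimal_degree_monic_in C f \<longleftrightarrow> is_arg_min degree (\<lambda>h. h \<in> C \<and> lead_coeff h = 1) f"

text \<open>The action of the constants on \<open>R\<^sub>n\<close> is \<open>smult\<close> (see \<open>skew_act_const\<close> below), so
  \<open>R\<close>-linear combinations are those of the module \<open>smult\<close>.\<close>

definition minimal_generating_set :: "'r::comm_ring_1 poly set \<Rightarrow> 'r poly set \<Rightarrow> bool" where
  "minimal_generating_set C B \<longleftrightarrow>
     B \<subseteq> C \<and> Modules.module.span smult B = C \<and> (\<forall>b\<in>B. b \<notin> Modules.module.span smult (B - {b}))"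

section \<open>Basic facts\<close>

lemma module_smult: "Modules.module (smult :: 'r::comm_ring_1 \<Rightarrow> 'r poly \<Rightarrow> 'r poly)"
  by unfold_locales (auto simp: smult_add_right smult_add_left)

lemma funpow_ring_hom:
  fixes \<theta> :: "'r::comm_ring_1 \<Rightarrow> 'r"
  assumes "comm_ring_hom \<theta>"
  shows "comm_ring_hom (\<theta> ^^ i)"
proof -
  interpret comm_ring_hom \<theta> by fact
  show ?thesis
    by (induction i) (unfold_locales, auto simp: comm_ring_hom_def ring_hom_def hom_distribs
      semiring_hom_def comm_monoid_add_hom_def monoid_add_hom_def zero_hom_def
      semigroup_add_hom_def plus_hom_def monoid_mult_hom_def one_hom_def semigroup_mult_hom_def
      times_hom_def)
qed

context
  fixes \<theta> :: "'r::comm_ring_1 \<Rightarrow> 'r"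
  assumes hom: "comm_ring_hom \<theta>"
begin

interpretation pw: comm_ring_hom "\<theta> ^^ i" for i
  by (rule funpow_ring_hom [OF hom])

lemma coeff_skew_mult:
  "coeff (skew_mult \<theta> f g) k = (\<Sum>i\<le>k. coeff f i * (\<theta> ^^ i) (coeff g (k - i)))"
proof -
  have "coeff (skew_mult \<theta> f g) k =
      (\<Sum>i\<le>degree f. \<Sum>j\<le>degree g. if i + j = k then coeff f i * (\<theta> ^^ i) (coeff g j) else 0)"
    by (simp add: skew_mult_def coeff_sum)
  also have "\<dots> = (\<Sum>i\<le>degree f. if i \<le> k then coeff f i * (\<theta> ^^ i) (coeff g (k - i)) else 0)"
  proof (rule sum.cong [OF refl])
    fix i
    have "(\<Sum>j\<le>degree g. if i + j = k then coeff f i * (\<theta> ^^ i) (coeff g j) else 0)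
        = (\<Sum>j\<le>degree g. if j = k - i then
             (if i \<le> k then coeff f i * (\<theta> ^^ i) (coeff g (k - i)) else 0) else 0)"
      by (intro sum.cong) auto
    also have "\<dots> = (if i \<le> k then coeff f i * (\<theta> ^^ i) (coeff g (k - i)) else 0)"
      by (subst sum.delta) (auto simp: coeff_eq_0 not_le)
    finally show "(\<Sum>j\<le>degree g. if i + j = k then coeff f i * (\<theta> ^^ i) (coeff g j) else 0)
        = (if i \<le> k then coeff f i * (\<theta> ^^ i) (coeff g (k - i)) else 0)" .
  qed
  also have "\<dots> = (\<Sum>i\<in>{..degree f} \<inter> {..k}. coeff f i * (\<theta> ^^ i) (coeff g (k - i)))"
    by (subst sum.inter_restrict) auto
  also have "\<dots> = (\<Sum>i\<le>k. coeff f i * (\<theta> ^^ i) (coeff g (k - i)))"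
    by (rule sum.mono_neutral_left) (auto, metis coeff_eq_0 linorder_not_le mult_zero_left)
  finally show ?thesis .
qed

lemma skew_mult_monom: "skew_mult \<theta> (monom a i) (monom b j) = monom (a * (\<theta> ^^ i) b) (i + j)"
proof (rule poly_eqI)
  fix k
  have "coeff (skew_mult \<theta> (monom a i) (monom b j)) k =
      (\<Sum>l\<le>k. if l = i then a * (\<theta> ^^ i) (coeff (monom b j) (k - i)) else 0)"
    unfolding coeff_skew_mult by (intro sum.cong) auto
  also have "\<dots> = (if i \<le> k then a * (\<theta> ^^ i) (coeff (monom b j) (k - i)) else 0)"
    by (subst sum.delta) auto
  also have "\<dots> = coeff (monom (a * (\<theta> ^^ i) b) (i + j)) k"
    by auto
  finally show "coeff (skew_mult \<theta> (monom a i) (monom b j)) k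
      = coeff (monom (a * (\<theta> ^^ i) b) (i + j)) k" .
qed

lemma skew_mult_add_left: "skew_mult \<theta> (f + g) h = skew_mult \<theta> f h + skew_mult \<theta> g h"
  by (rule poly_eqI) (simp add: coeff_skew_mult algebra_simps sum.distrib)

lemma skew_mult_add_right: "skew_mult \<theta> f (g + h) = skew_mult \<theta> f g + skew_mult \<theta> f h"
  by (rule poly_eqI) (simp add: coeff_skew_mult pw.hom_add algebra_simps sum.distrib)

lemma skew_mult_diff_right: "skew_mult \<theta> f (g - h) = skew_mult \<theta> f g - skew_mult \<theta> f h"
  by (rule poly_eqI) (simp add: coeff_skew_mult pw.hom_minus algebra_simps sum_subtractf)

lemma skew_mult_diff_left: "skew_mult \<theta> (f - g) h = skew_mult \<theta> f h - skew_mult \<theta> g h"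
  by (rule poly_eqI) (simp add: coeff_skew_mult algebra_simps sum_subtractf)

lemma skew_mult_0_left [simp]: "skew_mult \<theta> 0 f = 0"
  by (simp add: poly_eq_iff coeff_skew_mult)

lemma skew_mult_0_right [simp]: "skew_mult \<theta> f 0 = 0"
  by (simp add: poly_eq_iff coeff_skew_mult)

lemma skew_mult_sum_left: "skew_mult \<theta> (\<Sum>i\<in>A. f i) g = (\<Sum>i\<in>A. skew_mult \<theta> (f i) g)"
  by (induction A rule: infinite_finite_induct) (auto simp: skew_mult_add_left)

lemma skew_mult_sum_right: "skew_mult \<theta> g (\<Sum>i\<in>A. f i) = (\<Sum>i\<in>A. skew_mult \<theta> g (f i))"
  by (induction A rule: infinite_finite_induct) (auto simp: skew_mult_add_right)

lemma skew_mult_const: "skew_mult \<theta> [:c:] f = smult c f"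
proof (rule poly_eqI)
  fix k
  have "coeff (skew_mult \<theta> [:c:] f) k = (\<Sum>i\<le>k. if i = 0 then c * coeff f k else 0)"
    unfolding coeff_skew_mult by (intro sum.cong) (auto simp: coeff_pCons split: nat.splits)
  then show "coeff (skew_mult \<theta> [:c:] f) k = coeff (smult c f) k"
    by simp
qed

lemma skew_mult_assoc:
  "skew_mult \<theta> (skew_mult \<theta> f g) h = skew_mult \<theta> f (skew_mult \<theta> g h)"
proof -
  have *: "skew_mult \<theta> (skew_mult \<theta> (monom a i) (monom b j)) (monom c k)
      = skew_mult \<theta> (monom a i) (skew_mult \<theta> (monom b j) (monom c k))" for a b c i j k
    by (simp add: skew_mult_monom pw.hom_mult funpow_add mult.assoc add.assoc)
  have "skew_mult \<theta> (skew_mult \<theta> (\<Sum>i\<le>degree f. monom (coeff f i) i)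
            (\<Sum>i\<le>degree g. monom (coeff g i) i)) (\<Sum>i\<le>degree h. monom (coeff h i) i)
      = skew_mult \<theta> (\<Sum>i\<le>degree f. monom (coeff f i) i) (skew_mult \<theta>
            (\<Sum>i\<le>degree g. monom (coeff g i) i) (\<Sum>i\<le>degree h. monom (coeff h i) i))"
    by (simp only: skew_mult_sum_left skew_mult_sum_right *)
  then show ?thesis
    by (simp only: poly_as_sum_of_monoms)
qed

lemma skew_mult_xn1: "skew_mult \<theta> q (xn1 n) = xn1 n * q"
proof -
  have "skew_mult \<theta> q (monom 1 m) = monom 1 m * q" for m
  proof -
    have "skew_mult \<theta> (\<Sum>i\<le>degree q. monom (coeff q i) i) (monom 1 m)
        = monom 1 m * (\<Sum>i\<le>degree q. monom (coeff q i) i)"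
      by (simp only: skew_mult_sum_left skew_mult_monom sum_distrib_left mult_monom
          pw.hom_one mult_1_left mult_1_right add.commute)
    then show ?thesis
      by (simp only: poly_as_sum_of_monoms)
  qed
  from this [of n] this [of 0] show ?thesis
    by (simp add: skew_mult_diff_right algebra_simps monom_0 one_pCons [symmetric])
qed

lemma xn1_ideal_iff: "f \<in> xn1_ideal \<theta> n \<longleftrightarrow> xn1 n dvd f"
  by (auto simp: xn1_ideal_def skew_mult_xn1 dvd_def)

lemma residue_unique:
  assumes "n \<ge> 1"
  shows "\<exists>!r. r \<in> Rn n \<and> f - r \<in> xn1_ideal \<theta> n"
proof -
  have step: "xn1 n dvd monom a k - monom a (k mod n)" for a :: 'r and k
  proof (induction k rule: less_induct)
    case (less k)
    show ?case
    proof (cases "k < n")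
      case False
      have "monom a k - monom a (k - n) = xn1 n * monom a (k - n)"
        using False by (simp add: algebra_simps mult_monom)
      then have "xn1 n dvd monom a k - monom a (k - n)"
        by (metis dvd_triv_left)
      moreover have "xn1 n dvd monom a (k - n) - monom a (k mod n)"
        using less.IH [of "k - n"] False assms by (simp add: le_mod_geq)
      ultimately have "xn1 n dvd (monom a k - monom a (k - n)) +
          (monom a (k - n) - monom a (k mod n))"
        by (rule dvd_add)
      then show ?thesis
        by simp
    qed simp
  qed
  define r where "r = (\<Sum>k\<le>degree f. monom (coeff f k) (k mod n))"
  have "degree r < n"
    unfolding r_def using assms
    by (intro degree_sum_less) (auto intro: le_less_trans [OF degree_monom_le])
  moreover have "xn1 n dvd f - r"
  proof -
    have "f - r = (\<Sum>k\<le>degree f. monom (coeff f k) k - monom (coeff f k) (k mod n))"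
      unfolding r_def sum_subtractf by (simp add: poly_as_sum_of_monoms)
    then show ?thesis
      by (simp add: dvd_sum step)
  qed
  moreover have "r1 = r2"
    if "degree r1 < n" "xn1 n dvd f - r1" "degree r2 < n" "xn1 n dvd f - r2" for r1 r2
  proof -
    have "xn1 n dvd (f - r1) - (f - r2)"
      using that by (metis dvd_diff)
    then obtain q where q: "r2 - r1 = xn1 n * q"
      by (auto simp: dvd_def)
    have "q = 0"
    proof (rule ccontr)
      assume "q \<noteq> 0"
      have "coeff (xn1 n * q) (n + degree q) = lead_coeff q"
        using assms by (simp add: left_diff_distrib coeff_monom_mult coeff_eq_0)
      moreover have "degree (r2 - r1) < n"
        using that by (intro degree_diff_less)
      ultimately show False
        using \<open>q \<noteq> 0\<close> q by (metis add_lessD1 coeff_eq_0 leading_coeff_0_iff not_less_iff_gr_or_eq trans_less_add1)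
    qed
    then show ?thesis
      using q by simp
  qed
  ultimately show ?thesis
    unfolding Rn_def xn1_ideal_iff by (intro ex1I [of _ r]) auto
qed

lemma residue_props:
  assumes "n \<ge> 1"
  shows "residue \<theta> n f \<in> Rn n" "f - residue \<theta> n f \<in> xn1_ideal \<theta> n"
  using theI' [OF residue_unique [OF assms, of f]] unfolding residue_def by auto

lemma residue_eqI:
  assumes "n \<ge> 1" "r \<in> Rn n" "f - r \<in> xn1_ideal \<theta> n"
  shows "residue \<theta> n f = r"
  using residue_unique [OF assms(1), of f] residue_props [OF assms(1), of f] assms by blast

lemma residue_eq_iff:
  assumes "n \<ge> 1"
  shows "residue \<theta> n f = residue \<theta> n g \<longleftrightarrow> f - g \<in> xn1_ideal \<theta> n"
proof
  assume "residue \<theta> n f = residue \<theta> n g"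
  then have "xn1 n dvd (f - residue \<theta> n f) - (g - residue \<theta> n f)"
    using residue_props [OF assms] by (metis xn1_ideal_iff dvd_diff)
  then show "f - g \<in> xn1_ideal \<theta> n"
    by (simp add: xn1_ideal_iff)
next
  assume "f - g \<in> xn1_ideal \<theta> n"
  then have "xn1 n dvd (f - g) + (g - residue \<theta> n g)"
    using residue_props [OF assms] by (intro dvd_add) (metis xn1_ideal_iff)+
  then show "residue \<theta> n f = residue \<theta> n g"
    using residue_props [OF assms] by (intro residue_eqI [OF assms]) (auto simp: xn1_ideal_iff)
qed

lemma residue_Rn:
  assumes "n \<ge> 1" "f \<in> Rn n"
  shows "residue \<theta> n f = f"
  using assms by (intro residue_eqI) (auto simp: xn1_ideal_iff)

lemma skew_act_residue:
  assumes "n \<ge> 1"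
  shows "skew_act \<theta> n r (residue \<theta> n f) = residue \<theta> n (skew_mult \<theta> r f)"
proof -
  obtain q where "f - residue \<theta> n f = skew_mult \<theta> q (xn1 n)"
    using residue_props [OF assms, of f] by (auto simp: xn1_ideal_def)
  then have "skew_mult \<theta> r f - skew_mult \<theta> r (residue \<theta> n f)
      = skew_mult \<theta> (skew_mult \<theta> r q) (xn1 n)"
    by (simp add: skew_mult_assoc skew_mult_diff_right [symmetric])
  then have "skew_mult \<theta> r f - skew_mult \<theta> r (residue \<theta> n f) \<in> xn1_ideal \<theta> n"
    by (auto simp: xn1_ideal_def)
  then show ?thesis
    unfolding skew_act_def by (metis assms residue_eq_iff)
qed

lemma skew_act_const:
  assumes "n \<ge> 1" "f \<in> Rn n"
  shows "skew_act \<theta> n [:c:] f = smult c f"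
  using assms by (auto simp: skew_act_def skew_mult_const Rn_def
      intro!: residue_Rn le_less_trans [OF degree_smult_le])

end

end

theory Submission
  imports Defs
begin

text \<open>The automorphism acts trivially modulo \<open>u\<close>, so the first component \<open>fst_poly\<close> turns the skew
  product into the ordinary product over the prime field. A code \<open>C\<close> is therefore determined up to
  extension by its image modulo \<open>u\<close>, whose nonzero elements have degree at least \<open>r\<close>, and by its
  \<open>u\<close>-multiples, whose nonzero elements have degree at least \<open>t\<close>. The shifts of the generators
  realise every degree from \<open>r\<close> to \<open>n - 1\<close> in the former and every degree from \<open>t\<close> to \<open>n - 1\<close> in
  the latter (where \<open>u\<close> times the shifts of the first generator contribute the degrees from \<open>r\<close>
  on), so elimination of leading terms gives spanning, and distinctness of the degrees gives
  minimality and the cardinality. Parts 1 and 2 are the extreme cases \<open>r = n\<close> and \<open>t = r\<close>.\<close>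

section \<open>Polynomials over the dual numbers\<close>

abbreviation fst_poly :: "'a::comm_ring_1 dual poly \<Rightarrow> 'a poly" where
  "fst_poly \<equiv> map_poly fst_part"

abbreviation snd_poly :: "'a::comm_ring_1 dual poly \<Rightarrow> 'a poly" where
  "snd_poly \<equiv> map_poly snd_part"

lemma fst_part_simps [simp]:
  "fst_part 0 = 0" "fst_part 1 = 1" "fst_part (x + y) = fst_part x + fst_part y"
  "fst_part (x - y) = fst_part x - fst_part y" "fst_part (- x) = - fst_part x"
  "fst_part (x * y) = fst_part x * fst_part y"
  by (simp_all add: dual_ring_defs)

lemma snd_part_simps [simp]:
  "snd_part 0 = 0" "snd_part 1 = 0" "snd_part (x + y) = snd_part x + snd_part y"
  "snd_part (x - y) = snd_part x - snd_part y" "snd_part (- x) = - snd_part x"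
  "snd_part (x * y) = fst_part x * snd_part y + snd_part x * fst_part y"
  by (simp_all add: dual_ring_defs)

lemma u_elem_parts [simp]: "fst_part u_elem = 0" "snd_part u_elem = 1"
  by (simp_all add: u_elem_def)

lemma comm_ring_hom_fst_part: "comm_ring_hom fst_part"
  by unfold_locales auto

interpretation fst_part: comm_ring_hom fst_part
  by (rule comm_ring_hom_fst_part)

interpretation fst_poly: map_poly_comm_ring_hom fst_part ..

lemma coeff_fst_poly [simp]: "coeff (fst_poly f) k = fst_part (coeff f k)"
  by (simp add: coeff_map_poly)

lemma coeff_snd_poly [simp]: "coeff (snd_poly f) k = snd_part (coeff f k)"
  by (simp add: coeff_map_poly)

lemma coeff_base_poly [simp]: "coeff (base_poly f) k = Dual (coeff f k) 0"
  by (simp add: base_poly_def coeff_map_poly zero_dual_def)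

lemma coeff_u_poly: "coeff (u_poly f) k = Dual 0 (coeff f k)"
  by (simp add: dual_ring_defs u_elem_def)

lemma fst_poly_smult: "fst_poly (smult c f) = smult (fst_part c) (fst_poly f)"
  by (rule poly_eqI) simp

lemma fst_poly_base_poly [simp]: "fst_poly (base_poly f) = f"
  by (rule poly_eqI) simp

lemma fst_poly_u_poly [simp]: "fst_poly (u_poly f) = 0"
  by (rule poly_eqI) simp

lemma snd_poly_u_poly [simp]: "snd_poly (u_poly f) = f"
  by (rule poly_eqI) simp

lemma u_poly_snd_poly: "fst_poly f = 0 \<Longrightarrow> u_poly (snd_poly f) = f"
  by (rule poly_eqI) (metis coeff_0 coeff_fst_poly coeff_snd_poly coeff_u_poly dual.collapse)

lemma u_poly_fst_poly: "u_poly (fst_poly f) = smult u_elem f"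
  by (rule poly_eqI) (simp add: dual_ring_defs u_elem_def)

text \<open>Since u squared is 0, scalars act on u-multiples through their first component, so the
  u-multiples behave like a vector space over the field.\<close>

lemma smult_u_poly: "smult c (u_poly f) = u_poly (smult (fst_part c) f)"
  by (rule poly_eqI) (simp add: dual_ring_defs u_elem_def)

lemma u_poly_add: "u_poly (f + g) = u_poly f + u_poly g"
  by (rule poly_eqI) (simp add: dual_ring_defs u_elem_def)

lemma u_poly_diff: "u_poly (f - g) = u_poly f - u_poly g"
  by (rule poly_eqI) (simp add: dual_ring_defs u_elem_def)

lemma u_poly_0 [simp]: "u_poly 0 = 0"
  by (rule poly_eqI) (simp add: dual_ring_defs u_elem_def)

lemma u_poly_eq_0_iff [simp]: "u_poly f = 0 \<longleftrightarrow> f = 0"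
  by (metis map_poly_0 snd_poly_u_poly u_poly_0)

lemma u_poly_sum: "u_poly (\<Sum>i\<in>I. f i) = (\<Sum>i\<in>I. u_poly (f i))"
  by (induction I rule: infinite_finite_induct) (auto simp: u_poly_add)

lemma degree_u_poly [simp]: "degree (u_poly f) = degree f"
proof (rule antisym)
  show "degree (u_poly f) \<le> degree f"
    by (rule degree_le) (simp add: coeff_u_poly coeff_eq_0 zero_dual_def del: coeff_smult)
  show "degree f \<le> degree (u_poly f)"
    by (metis degree_map_poly_le snd_poly_u_poly)
qed

lemma degree_smult_u_elem: "degree (smult u_elem f) = degree (fst_poly f)"
  by (metis degree_u_poly u_poly_fst_poly)

lemma smult_u_elem_eq_0_iff: "smult u_elem f = 0 \<longleftrightarrow> fst_poly f = 0"
  by (metis u_poly_eq_0_iff u_poly_fst_poly)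

section \<open>Generating families in echelon form\<close>

text \<open>Among the members with nonzero coefficient, the one of largest degree has a leading term
  that nothing else can cancel. Indexing by \<open>I\<close> allows a disjoint sum of two
  families.\<close>

lemma distinct_degree_independent:
  fixes F :: "'i \<Rightarrow> 'a::idom poly"
  assumes fin: "finite I" and nz: "\<And>i. i \<in> I \<Longrightarrow> F i \<noteq> 0"
    and inj: "inj_on (\<lambda>i. degree (F i)) I"
    and sum: "(\<Sum>i\<in>I. smult (c i) (F i)) = 0" and i: "i \<in> I"
  shows "c i = 0"
proof (rule ccontr)
  assume "c i \<noteq> 0"
  define J where "J = {i \<in> I. c i \<noteq> 0}"
  have J: "finite J" "J \<noteq> {}"
    using fin i \<open>c i \<noteq> 0\<close> by (auto simp: J_def)
  then have "Max ((\<lambda>i. degree (F i)) ` J) \<in> (\<lambda>i. degree (F i)) ` J"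
    by (intro Max_in) auto
  then obtain j where j: "j \<in> J" and D: "degree (F j) = Max ((\<lambda>i. degree (F i)) ` J)"
    by auto
  have small: "c k * coeff (F k) (degree (F j)) = 0" if "k \<in> I" "k \<noteq> j" for k
  proof (cases "c k = 0")
    case False
    then have "degree (F k) \<le> degree (F j)"
      unfolding D using J that by (auto simp: J_def)
    moreover have "degree (F k) \<noteq> degree (F j)"
      using inj that j by (auto simp: J_def inj_on_def)
    ultimately show ?thesis
      by (simp add: coeff_eq_0)
  qed simp
  have "0 = (\<Sum>k\<in>I. c k * coeff (F k) (degree (F j)))"
    using arg_cong [OF sum, of "\<lambda>f. coeff f (degree (F j))"] by (simp add: coeff_sum)
  also have "\<dots> = (\<Sum>k\<in>{j}. c k * coeff (F k) (degree (F j)))"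
    using j small fin by (intro sum.mono_neutral_right) (auto simp: J_def)
  finally show False
    using j nz by (auto simp: J_def)
qed

text \<open>Degree bookkeeping detached from the skew product: only the module structure over the
  dual numbers remains. The degree of \<open>H i\<close> is prescribed only modulo u, since its
  u-part may have a higher one. Degrees are written as sums to avoid truncated subtraction.\<close>

locale echelon_system =
  fixes C :: "'a::field dual poly set" and A H :: "nat \<Rightarrow> 'a dual poly" and t l m :: nat
  assumes subspace: "Modules.module.subspace smult C"
    and A_in: "\<And>j. j < l \<Longrightarrow> A j \<in> C"
    and fst_A: "\<And>j. j < l \<Longrightarrow> fst_poly (A j) = 0"
    and A_nz: "\<And>j. j < l \<Longrightarrow> A j \<noteq> 0"
    and degree_A: "\<And>j. j < l \<Longrightarrow> degree (A j) = t + j"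
    and H_in: "\<And>i. i < m \<Longrightarrow> H i \<in> C"
    and fst_H_nz: "\<And>i. i < m \<Longrightarrow> fst_poly (H i) \<noteq> 0"
    and degree_fst_H: "\<And>i. i < m \<Longrightarrow> degree (fst_poly (H i)) = t + l + i"
    and degree_fst_ge: "\<And>f. f \<in> C \<Longrightarrow> fst_poly f \<noteq> 0 \<Longrightarrow> t + l \<le> degree (fst_poly f)"
    and degree_u_ge: "\<And>f. u_poly f \<in> C \<Longrightarrow> f \<noteq> 0 \<Longrightarrow> t \<le> degree f"
    and degree_less: "\<And>f. f \<in> C \<Longrightarrow> degree f < t + l + m"
begin

interpretation M: Modules.module "smult :: 'a dual \<Rightarrow> 'a dual poly \<Rightarrow> 'a dual poly"
  by (rule module_smult)

text \<open>Coefficients are attached to positions and not to elements, so possible repetitions in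
  the families need no treatment.\<close>

definition comb :: "(nat \<Rightarrow> 'a dual) \<Rightarrow> (nat \<Rightarrow> 'a dual) \<Rightarrow> 'a dual poly" where
  "comb c d = (\<Sum>i<m. smult (c i) (H i)) + (\<Sum>j<l. smult (d j) (A j))"

lemma comb_add: "comb c d + comb c' d' = comb (\<lambda>i. c i + c' i) (\<lambda>j. d j + d' j)"
  by (simp add: comb_def smult_add_left sum.distrib)

lemma comb_diff: "comb c d - comb c' d' = comb (\<lambda>i. c i - c' i) (\<lambda>j. d j - d' j)"
  by (simp add: comb_def smult_diff_left sum_subtractf)

lemma comb_smult: "smult a (comb c d) = comb (\<lambda>i. a * c i) (\<lambda>j. a * d j)"
proof -
  have *: "smult a (\<Sum>i\<in>I. f i) = (\<Sum>i\<in>I. smult a (f i))" for f :: "nat \<Rightarrow> 'a dual poly" and I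
    by (rule M.scale_sum_right)
  show ?thesis
    by (simp add: comb_def smult_add_right *)
qed

lemma comb_H: "i < m \<Longrightarrow> H i = comb (\<lambda>k. if k = i then 1 else 0) (\<lambda>_. 0)"
  by (simp add: comb_def if_distrib [of "\<lambda>x. smult x _"] sum.delta cong: if_cong)

lemma comb_A: "j < l \<Longrightarrow> A j = comb (\<lambda>_. 0) (\<lambda>k. if k = j then 1 else 0)"
  by (simp add: comb_def if_distrib [of "\<lambda>x. smult x _"] sum.delta cong: if_cong)

text \<open>Used with \<open>Q\<close> always true to describe the span, and with \<open>Q\<close>
  saying that one chosen coefficient vanishes to prove that no generator is redundant.\<close>

lemma subspace_comb:
  assumes "\<And>c d c' d'. Q c d \<Longrightarrow> Q c' d' \<Longrightarrow> Q (\<lambda>i. c i + c' i) (\<lambda>j. d j + d' j)"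
    and "\<And>a c d. Q c d \<Longrightarrow> Q (\<lambda>i. a * c i) (\<lambda>j. a * d j)"
    and "Q (\<lambda>_. 0) (\<lambda>_. 0)"
  shows "M.subspace {comb c d | c d. Q c d}"
proof (rule M.subspaceI)
  show "0 \<in> {comb c d | c d. Q c d}"
    using assms(3) by (auto simp: comb_def intro!: exI [of _ "\<lambda>_. 0"])
qed (use assms(1,2) in \<open>auto simp: comb_add comb_smult, (blast intro: assms)+\<close>)

lemma span_eq_comb: "M.span (H ` {..<m} \<union> A ` {..<l}) = {comb c d | c d. True}"
proof
  have "M.subspace {comb c d | c d. True}"
    by (rule subspace_comb) auto
  then show "M.span (H ` {..<m} \<union> A ` {..<l}) \<subseteq> {comb c d | c d. True}"
    by (intro M.span_minimal) (use comb_H comb_A in blast)+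
  show "{comb c d | c d. True} \<subseteq> M.span (H ` {..<m} \<union> A ` {..<l})"
  proof clarify
    fix c d
    show "comb c d \<in> M.span (H ` {..<m} \<union> A ` {..<l})"
      unfolding comb_def by (intro M.span_add M.span_sum M.span_scale) (auto intro: M.span_base)
  qed
qed

lemma span_subset: "M.span (H ` {..<m} \<union> A ` {..<l}) \<subseteq> C"
  by (intro M.span_minimal subspace) (auto intro: A_in H_in)

text \<open>Modulo \<open>u\<close> the \<open>A j\<close> vanish, so the \<open>fst_poly (H i)\<close> have to be independent; the
  \<open>u\<close>-multiples are handled by the polynomials \<open>fst_poly (H i)\<close> and \<open>snd_poly (A j)\<close> together, whose
  degrees exhaust \<open>{t..<t + l + m}\<close>.\<close>

lemma degree_snd_A: "j < l \<Longrightarrow> degree (snd_poly (A j)) = t + j"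
  by (metis degree_A degree_u_poly fst_A u_poly_snd_poly)

lemma snd_A_nz: "j < l \<Longrightarrow> snd_poly (A j) \<noteq> 0"
  by (metis A_nz fst_A u_poly_0 u_poly_snd_poly)

text \<open>Only the first component of \<open>d j\<close> can be recovered, because u annihilates
  \<open>A j\<close>.\<close>

lemma comb_eq_0:
  assumes "comb c d = 0"
  shows "\<forall>i<m. c i = 0" and "\<forall>j<l. fst_part (d j) = 0"
proof -
  have "(\<Sum>i<m. smult (fst_part (c i)) (fst_poly (H i))) = fst_poly (comb c d)"
    by (simp add: comb_def fst_poly.hom_add fst_poly.hom_sum fst_poly_smult fst_A)
  then have fc: "fst_part (c i) = 0" if "i < m" for i
    using that assms
    by (intro distinct_degree_independent [of "{..<m}" "\<lambda>i. fst_poly (H i)" "\<lambda>i. fst_part (c i)"])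
      (auto simp: fst_H_nz degree_fst_H inj_on_def)
  \<comment> \<open>Now \<open>c i\<close> is a multiple of u, so its product with
    \<open>H i\<close> depends only on \<open>H i\<close> modulo u.\<close>
  have 1: "smult (c i) (H i) = u_poly (smult (snd_part (c i)) (fst_poly (H i)))" if "i < m" for i
    using fc [OF that] by (intro poly_eqI) (simp add: dual_ring_defs u_elem_def dual.expand)
  have 2: "smult (d j) (A j) = u_poly (smult (fst_part (d j)) (snd_poly (A j)))" if "j < l" for j
    by (subst u_poly_snd_poly [OF fst_A [OF that], symmetric]) (rule smult_u_poly)
  \<comment> \<open>The disjoint sum merges both families. Their degrees \<open>t + l + i\<close>
    and \<open>t + j\<close> with \<open>j < l\<close> never coincide, so a single use of
    independence handles all coefficients.\<close>
  define F where "F = case_sum (\<lambda>i. fst_poly (H i)) (\<lambda>j. snd_poly (A j))"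
  define a where "a = case_sum (\<lambda>i. snd_part (c i)) (\<lambda>j. fst_part (d j))"
  have "u_poly (\<Sum>k\<in>{..<m} <+> {..<l}. smult (a k) (F k)) = comb c d"
    by (simp add: sum.Plus F_def a_def u_poly_add u_poly_sum comb_def 1 2)
  then have "(\<Sum>k\<in>{..<m} <+> {..<l}. smult (a k) (F k)) = 0"
    using assms by simp
  then have a: "a k = 0" if "k \<in> {..<m} <+> {..<l}" for k
    using that by (intro distinct_degree_independent [of "{..<m} <+> {..<l}" F a])
      (auto simp: F_def inj_on_def degree_fst_H degree_snd_A fst_H_nz snd_A_nz)
  have "snd_part (c i) = 0" if "i < m" for i
    using a [OF InlI, of i] that by (simp add: a_def)
  with fc show "\<forall>i<m. c i = 0"
    by (auto simp: dual_ring_defs dual.expand)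
  show "\<forall>j<l. fst_part (d j) = 0"
    using a [OF InrI] by (simp add: a_def)
qed

text \<open>Leading terms are eliminated by some \<open>A j\<close> in degrees below
  \<open>t + l\<close>, and from there on by u times some \<open>H i\<close>. After cancelling u the
  coefficients lie in a field, so leading coefficients can be divided.\<close>

lemma u_poly_in_span:
  "u_poly f \<in> C \<Longrightarrow> u_poly f \<in> M.span (H ` {..<m} \<union> A ` {..<l})" (is "_ \<Longrightarrow> _ \<in> ?S")
proof (induction "degree f" arbitrary: f rule: less_induct)
  case less
  show ?case
  proof (cases "f = 0")
    case True
    then show ?thesis by (simp add: M.span_zero)
  next
    case False
    have deg: "t \<le> degree f" "degree f < t + l + m"
      using degree_u_ge degree_less [OF less.prems] less.prems False by auto
    obtain b where b: "u_poly b \<in> ?S" "b \<noteq> 0" "degree b = degree f"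
    proof (cases "degree f < t + l")
      case True
      define j where "j = degree f - t"
      have "j < l" "degree f = t + j"
        using True deg by (auto simp: j_def)
      then show ?thesis
        using that [of "snd_poly (A j)"]
        by (simp add: degree_snd_A snd_A_nz u_poly_snd_poly fst_A M.span_base)
    next
      case False
      define i where "i = degree f - (t + l)"
      have "i < m" "degree f = t + l + i"
        using False deg by (auto simp: i_def)
      moreover have "smult u_elem (H i) \<in> ?S"
        using \<open>i < m\<close> by (intro M.span_scale M.span_base) auto
      ultimately show ?thesis
        using that [of "fst_poly (H i)"] degree_fst_H fst_H_nz by (simp add: u_poly_fst_poly)
    qed
    define q where "q = lead_coeff f / lead_coeff b"
    \<comment> \<open>\<open>Dual q 0\<close> is the field element \<open>q\<close> viewed as a
      scalar of the ring.\<close>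
    have q: "u_poly (smult q b) \<in> ?S"
      using M.span_scale [OF b(1), of "Dual q 0"] by (simp only: smult_u_poly dual.sel)
    define f' where "f' = f - smult q b"
    \<comment> \<open>The zero case is separate because 0 has degree 0: for constant
      \<open>f\<close> the degree does not drop.\<close>
    have "f' = 0 \<or> degree f' < degree f"
    proof -
      have "coeff f' (degree f) = 0"
        using b(2) by (simp add: f'_def q_def flip: b(3))
      moreover have "degree f' \<le> degree f"
        unfolding f'_def using b by (intro degree_diff_le) auto
      ultimately show ?thesis
        by (metis le_neq_implies_less leading_coeff_0_iff)
    qed
    moreover have "u_poly f' \<in> C"
      unfolding f'_def u_poly_diff using M.subspace_diff [OF subspace less.prems] q span_subset by blast
    ultimately have "u_poly f' \<in> ?S"
      using less.hyps [of f'] by (auto simp: M.span_zero)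
    then have "u_poly f' + u_poly (smult q b) \<in> ?S"
      using q by (rule M.span_add)
    then show ?thesis
      by (simp add: f'_def u_poly_diff)
  qed
qed

text \<open>Leading terms modulo u are eliminated with the \<open>H i\<close> until a u-multiple
  remains, which \<open>u_poly_in_span\<close> covers. The induction measures the reduction modulo
  u, as the degree of \<open>f\<close> itself need not drop.\<close>

lemma in_span:
  "f \<in> C \<Longrightarrow> f \<in> M.span (H ` {..<m} \<union> A ` {..<l})" (is "_ \<Longrightarrow> _ \<in> ?S")
proof (induction "degree (fst_poly f)" arbitrary: f rule: less_induct)
  case less
  show ?case
  proof (cases "fst_poly f = 0")
    case True
    then show ?thesis
      using u_poly_in_span [of "snd_poly f"] less.prems by (simp add: u_poly_snd_poly)
  next
    case False
    define i where "i = degree (fst_poly f) - (t + l)"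
    have deg: "t + l \<le> degree (fst_poly f)" "degree (fst_poly f) < t + l + m"
      using degree_fst_ge [OF less.prems False] degree_less [OF less.prems]
        degree_map_poly_le [of fst_part f] by linarith+
    then have "i < m" "degree (fst_poly f) = t + l + i"
      by (simp_all add: i_def)
    then have i: "i < m" "degree (fst_poly (H i)) = degree (fst_poly f)"
      by (simp_all add: degree_fst_H)
    define q where "q = lead_coeff (fst_poly f) / lead_coeff (fst_poly (H i))"
    define f' where "f' = f - smult (Dual q 0) (H i)"
    have q: "smult (Dual q 0) (H i) \<in> ?S"
      using i by (intro M.span_scale M.span_base) auto
    have fst': "fst_poly f' = fst_poly f - smult q (fst_poly (H i))"
      by (simp add: f'_def fst_poly.hom_minus fst_poly_smult)
    have "f' \<in> C"
      unfolding f'_def using M.subspace_diff [OF subspace less.prems] q span_subset by blast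
    moreover have "fst_poly f' = 0 \<or> degree (fst_poly f') < degree (fst_poly f)"
    proof -
      have "lead_coeff (fst_poly (H i)) \<noteq> 0"
        using fst_H_nz [OF i(1)] by (rule leading_coeff_neq_0)
      then have "coeff (fst_poly f') (degree (fst_poly f)) = 0"
        unfolding fst' q_def by (simp add: i(2))
      moreover have "degree (fst_poly f') \<le> degree (fst_poly f)"
        unfolding fst' by (intro degree_diff_le order.trans [OF degree_smult_le]) (simp_all add: i(2))
      ultimately show ?thesis
        by (metis le_neq_implies_less leading_coeff_0_iff)
    qed
    ultimately have "f' \<in> ?S"
      using less.hyps [of f'] u_poly_in_span [of "snd_poly f'"] by (auto simp: u_poly_snd_poly)
    then have "f' + smult (Dual q 0) (H i) \<in> ?S"
      using q by (rule M.span_add)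
    then show ?thesis
      by (simp add: f'_def)
  qed
qed

lemma span_eq: "M.span (H ` {..<m} \<union> A ` {..<l}) = C"
  using in_span span_subset by blast

text \<open>All other generators lie in the submodule \<open>T\<close> of combinations whose
  coefficient at the chosen position is 0. If the chosen generator were in \<open>T\<close> too,
  subtracting its two representations would give a vanishing combination with coefficient 1
  there.\<close>

lemma minimal_generating_set: "minimal_generating_set C (H ` {..<m} \<union> A ` {..<l})"
proof -
  have "H i \<notin> M.span (H ` {..<m} \<union> A ` {..<l} - {H i})" if "i < m" for i
  proof
    define T where "T = {comb c d | c d. c i = 0}"
    have "M.subspace T"
      unfolding T_def by (rule subspace_comb) auto
    have "H k \<in> T" if "k < m" "H k \<noteq> H i" for k
    proof -
      have "i \<noteq> k"
        using that(2) by auto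
      show ?thesis
        unfolding T_def comb_H [OF that(1)]
        by (intro CollectI exI conjI, rule refl) (simp add: \<open>i \<noteq> k\<close>)
    qed
    moreover have "A j \<in> T" if "j < l" for j
      unfolding T_def comb_A [OF that] by (intro CollectI exI conjI, rule refl) simp
    ultimately have "H ` {..<m} \<union> A ` {..<l} - {H i} \<subseteq> T"
      by auto
    then have "M.span (H ` {..<m} \<union> A ` {..<l} - {H i}) \<subseteq> T"
      using \<open>M.subspace T\<close> by (rule M.span_minimal)
    moreover assume "H i \<in> M.span (H ` {..<m} \<union> A ` {..<l} - {H i})"
    ultimately obtain c d where "H i = comb c d" "c i = 0"
      unfolding T_def by blast
    with comb_H [OF that] have
      "comb (\<lambda>k. (if k = i then 1 else 0) - c k) (\<lambda>k. 0 - d k) = 0"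
      by (simp only: comb_diff [symmetric]) simp
    from comb_eq_0(1) [OF this] show False
      using that \<open>c i = 0\<close> by auto
  qed
  moreover have "A j \<notin> M.span (H ` {..<m} \<union> A ` {..<l} - {A j})" if "j < l" for j
  proof
    define T where "T = {comb c d | c d. d j = 0}"
    have "M.subspace T"
      unfolding T_def by (rule subspace_comb) auto
    have "H i \<in> T" if "i < m" for i
      unfolding T_def comb_H [OF that] by (intro CollectI exI conjI, rule refl) simp
    moreover have "A k \<in> T" if "k < l" "A k \<noteq> A j" for k
    proof -
      have "j \<noteq> k"
        using that(2) by auto
      show ?thesis
        unfolding T_def comb_A [OF that(1)]
        by (intro CollectI exI conjI, rule refl) (simp add: \<open>j \<noteq> k\<close>)
    qed
    ultimately have "H ` {..<m} \<union> A ` {..<l} - {A j} \<subseteq> T"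
      by auto
    then have "M.span (H ` {..<m} \<union> A ` {..<l} - {A j}) \<subseteq> T"
      using \<open>M.subspace T\<close> by (rule M.span_minimal)
    moreover assume "A j \<in> M.span (H ` {..<m} \<union> A ` {..<l} - {A j})"
    ultimately obtain c d where "A j = comb c d" "d j = 0"
      unfolding T_def by blast
    with comb_A [OF that] have
      "comb (\<lambda>k. 0 - c k) (\<lambda>k. (if k = j then 1 else 0) - d k) = 0"
      by (simp only: comb_diff [symmetric]) simp
    \<comment> \<open>The coefficient at \<open>j\<close> is 1, whose first component is nonzero, so
      the weaker vanishing statement for \<open>d\<close> is enough.\<close>
    from comb_eq_0(2) [OF this] show False
      using that \<open>d j = 0\<close> by auto
  qed
  ultimately show ?thesis
    unfolding minimal_generating_set_def span_eq using A_in H_in by auto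
qed

end

section \<open>Cardinality by counting normal forms\<close>

lemma card_UNIV_dual: "CARD('a::finite dual) = CARD('a) ^ 2"
proof -
  have "bij_betw (\<lambda>(a, b). Dual a b) (UNIV :: ('a \<times> 'a) set) UNIV"
    by (rule bij_betwI [of _ _ _ "\<lambda>x. (fst_part x, snd_part x)"]) auto
  from bij_betw_same_card [OF this] show ?thesis
    by (simp add: power2_eq_square)
qed

text \<open>Each element is a combination in exactly one way once the coefficients of the
  \<open>A j\<close> are taken from the field: the u-part of such a coefficient acts as 0, and
  \<open>comb_eq_0\<close> determines the rest.\<close>

lemma card_echelon_system:
  fixes C :: "'a::{field,finite} dual poly set"
  assumes "echelon_system C A H t l m"
  shows "card C = (CARD('a) ^ 2) ^ m * CARD('a) ^ l"
proof -
  interpret echelon_system C A H t l m by fact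
  \<comment> \<open>Extensional functions carry no information outside the index range, so distinct
    pairs are distinct coefficient lists.\<close>
  define X where "X = ({..<m} \<rightarrow>\<^sub>E (UNIV :: 'a dual set)) \<times> ({..<l} \<rightarrow>\<^sub>E (UNIV :: 'a set))"
  define \<Phi> where "\<Phi> = (\<lambda>(c, d). comb c (\<lambda>j. Dual (d j) 0))"
  have "inj_on \<Phi> X"
  proof (rule inj_onI)
    fix x y
    assume xy: "x \<in> X" "y \<in> X" "\<Phi> x = \<Phi> y"
    obtain c d c' d' where [simp]: "x = (c, d)" "y = (c', d')"
      by (cases x, cases y)
    have "comb (\<lambda>i. c i - c' i) (\<lambda>j. Dual (d j) 0 - Dual (d' j) 0) = 0"
      using xy(3) by (simp add: \<Phi>_def flip: comb_diff)
    note eq = comb_eq_0 [OF this]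
    have "c = c'"
      using eq(1) xy(1,2) by (intro PiE_ext [of c "{..<m}" "\<lambda>_. UNIV" c']) (auto simp: X_def)
    moreover have "d = d'"
      using eq(2) xy(1,2) by (intro PiE_ext [of d "{..<l}" "\<lambda>_. UNIV" d']) (auto simp: X_def)
    ultimately show "x = y"
      by simp
  qed
  moreover have "\<Phi> ` X = C"
  proof
    show "\<Phi> ` X \<subseteq> C"
      using span_eq span_eq_comb by (auto simp: \<Phi>_def)
    show "C \<subseteq> \<Phi> ` X"
    proof
      fix f
      assume "f \<in> C"
      then obtain c d where f: "f = comb c d"
        using span_eq span_eq_comb by auto
      have "smult (d j) (A j) = smult (Dual (fst_part (d j)) 0) (A j)" if "j < l" for j
        by (subst (1 2) u_poly_snd_poly [OF fst_A [OF that], symmetric])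
          (simp only: smult_u_poly dual.sel)
      then have "f = \<Phi> (restrict c {..<m}, restrict (\<lambda>j. fst_part (d j)) {..<l})"
        by (simp add: f \<Phi>_def comb_def)
      then show "f \<in> \<Phi> ` X"
        by (auto simp: X_def)
    qed
  qed
  ultimately have "card C = card X"
    by (metis card_image)
  then show ?thesis
    by (simp add: X_def card_cartesian_product card_funcsetE card_UNIV_dual)
qed

section \<open>Reduction modulo \<open>u\<close> of skew polynomials\<close>

lemma degree_xn1:
  assumes "n \<ge> 1"
  shows "degree (xn1 n :: 'a::comm_ring_1 poly) = n"
proof (rule antisym)
  show "degree (xn1 n :: 'a poly) \<le> n"
    by (intro degree_diff_le degree_monom_le) simp
  show "n \<le> degree (xn1 n :: 'a poly)"
    using assms by (intro le_degree) simp
qed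

lemma eq_if_xn1_dvd_diff:
  fixes f g :: "'a::field poly"
  assumes "xn1 n dvd f - g" "degree f < n" "degree g < n"
  shows "f = g"
proof (rule ccontr)
  assume "f \<noteq> g"
  then have "n \<le> degree (f - g)"
    using dvd_imp_degree_le [OF assms(1)] degree_xn1 [of n, where ?'a = 'a] assms(2) by simp
  with degree_diff_less [OF assms(2,3)] show False
    by simp
qed

lemma skew_cyclic_code_subspace:
  assumes "comm_ring_hom \<theta>" "n \<ge> 1" "skew_cyclic_code \<theta> n C"
  shows "Modules.module.subspace smult C"
proof (rule Modules.module.subspaceI [OF module_smult])
  show "smult c f \<in> C" if "f \<in> C" for c f
  proof -
    have "f \<in> Rn n" "skew_act \<theta> n [:c:] f \<in> C"
      using assms(3) that by (auto simp: skew_cyclic_code_def)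
    then show ?thesis
      using skew_act_const [OF assms(1,2)] by simp
  qed
qed (use assms(3) in \<open>auto simp: skew_cyclic_code_def\<close>)

text \<open>Over a prime field the second assumption holds for every ring endomorphism, by
  \<open>fst_part_ring_hom\<close>.\<close>

context
  fixes \<theta> :: "'a::field dual \<Rightarrow> 'a dual"
  assumes isom: "comm_ring_isom \<theta>" and fst_part_aut: "\<And>x. fst_part (\<theta> x) = fst_part x"
begin

interpretation isom: comm_ring_isom \<theta>
  by (rule isom)

lemma aut_comm_ring_hom: "comm_ring_hom \<theta>"
  by unfold_locales

interpretation pw: comm_ring_hom "\<theta> ^^ i" for i
  by (rule funpow_ring_hom [OF aut_comm_ring_hom])

lemma funpow_aut_eq_0_iff: "(\<theta> ^^ i) x = 0 \<longleftrightarrow> x = 0"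
  by (induction i) auto

lemma fst_part_funpow: "fst_part ((\<theta> ^^ i) x) = fst_part x"
  by (induction i) (auto simp: fst_part_aut)

text \<open>The twist by powers of \<open>\<theta>\<close> is invisible in the first component, so
  what remains is the ordinary convolution.\<close>

lemma fst_poly_skew_mult: "fst_poly (skew_mult \<theta> f g) = fst_poly f * fst_poly g"
  by (rule poly_eqI)
    (simp add: coeff_skew_mult [OF aut_comm_ring_hom] coeff_mult fst_part.hom_sum fst_part_funpow)

lemma fst_poly_xn1: "fst_poly (xn1 n) = xn1 n"
  by (rule poly_eqI) (simp add: if_distrib [of fst_part] coeff_1)

text \<open>The left ideal consists of the multiples of \<open>x^n - 1\<close> for the commutative
  product as well, and reduction modulo u respects that product.\<close>

lemma xn1_dvd_fst_poly_residue:
  assumes "n \<ge> 1"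
  shows "xn1 n dvd fst_poly f - fst_poly (residue \<theta> n f)"
proof -
  obtain q where "f - residue \<theta> n f = xn1 n * q"
    using residue_props(2) [OF aut_comm_ring_hom assms, of f] unfolding xn1_ideal_iff [OF aut_comm_ring_hom] by (rule dvdE)
  then have "fst_poly (f - residue \<theta> n f) = xn1 n * fst_poly q"
    by (simp only: fst_poly.hom_mult fst_poly_xn1)
  then show ?thesis
    unfolding fst_poly.hom_minus by (rule dvdI)
qed

text \<open>The elements of \<open>Rn n\<close> whose reduction is divisible by \<open>g\<close>
  form a code: passing to a residue changes the reduction by a multiple of \<open>x^n - 1\<close>,
  hence of \<open>g\<close>. This code contains the hull of \<open>S\<close>.\<close>

lemma dvd_fst_poly_generated_code:
  assumes "n \<ge> 1" "g dvd xn1 n" "S \<subseteq> Rn n" "\<And>s. s \<in> S \<Longrightarrow> g dvd fst_poly s"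
    and "f \<in> generated_code \<theta> n S"
  shows "g dvd fst_poly f"
proof -
  have "g dvd fst_poly (skew_act \<theta> n q f)" if "g dvd fst_poly f" for q f
  proof -
    have "g dvd fst_poly (skew_mult \<theta> q f)"
      using that by (simp add: fst_poly_skew_mult)
    moreover have "g dvd fst_poly (skew_mult \<theta> q f) - fst_poly (skew_act \<theta> n q f)"
      unfolding skew_act_def by (rule dvd_trans [OF assms(2) xn1_dvd_fst_poly_residue [OF assms(1)]])
    ultimately show ?thesis
      using dvd_diff [of g "fst_poly (skew_mult \<theta> q f)"
          "fst_poly (skew_mult \<theta> q f) - fst_poly (skew_act \<theta> n q f)"] by simp
  qed
  moreover have "skew_act \<theta> n q f \<in> Rn n" for q f
    unfolding skew_act_def by (rule residue_props(1) [OF aut_comm_ring_hom assms(1)])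
  ultimately have "skew_cyclic_code \<theta> n {f \<in> Rn n. g dvd fst_poly f}"
    using assms(1) by (auto simp: skew_cyclic_code_def Rn_def fst_poly.hom_add degree_add_less)
  then have "generated_code \<theta> n S \<subseteq> {f \<in> Rn n. g dvd fst_poly f}"
    using assms(3,4) by (intro hull_minimal) auto
  with assms(5) show ?thesis
    by auto
qed

text \<open>Both sides are congruent modulo \<open>x^n - 1\<close> and have degree below
  \<open>n\<close>. Asking only for a congruence between \<open>h\<close> and \<open>g\<close>
  admits an \<open>h\<close> defined as a residue.\<close>

lemma fst_poly_skew_act_monom:
  assumes "n \<ge> 1" "xn1 n dvd fst_poly h - g" "degree g + i < n"
  shows "fst_poly (skew_act \<theta> n (monom 1 i) h) = monom 1 i * g"
proof (rule eq_if_xn1_dvd_diff)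
  have "fst_poly (monom 1 i) = monom 1 i"
    by (rule poly_eqI) (simp add: if_distrib [of fst_part])
  then have "xn1 n dvd monom 1 i * fst_poly h - fst_poly (skew_act \<theta> n (monom 1 i) h)"
    using xn1_dvd_fst_poly_residue [OF assms(1), of "skew_mult \<theta> (monom 1 i) h"]
    by (simp add: fst_poly_skew_mult skew_act_def)
  moreover have "xn1 n dvd monom 1 i * fst_poly h - monom 1 i * g"
    using dvd_mult [OF assms(2)] by (simp only: right_diff_distrib)
  ultimately have "xn1 n dvd (monom 1 i * fst_poly h - monom 1 i * g) -
      (monom 1 i * fst_poly h - fst_poly (skew_act \<theta> n (monom 1 i) h))"
    by (metis dvd_diff)
  then show "xn1 n dvd fst_poly (skew_act \<theta> n (monom 1 i) h) - monom 1 i * g"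
    by simp
  show "degree (fst_poly (skew_act \<theta> n (monom 1 i) h)) < n"
    using residue_props(1) [OF aut_comm_ring_hom assms(1), of "skew_mult \<theta> (monom 1 i) h"]
    unfolding skew_act_def Rn_def by (auto intro: le_less_trans [OF degree_map_poly_le])
  show "degree (monom 1 i * g) < n"
    using assms(3) degree_mult_le [of "monom 1 i" g] degree_monom_le [of "1::'a" i] by linarith
qed

text \<open>Powers of \<open>\<theta>\<close> are injective, so the leading coefficient survives the
  shift, and below degree \<open>n\<close> the residue changes nothing.\<close>

lemma skew_act_monom_torsion:
  assumes "n \<ge> 1" "f \<noteq> 0" "fst_poly f = 0" "degree f + i < n"
  shows "skew_act \<theta> n (monom 1 i) f \<noteq> 0"
    and "degree (skew_act \<theta> n (monom 1 i) f) = degree f + i"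
    and "fst_poly (skew_act \<theta> n (monom 1 i) f) = 0"
proof -
  define F where "F = skew_mult \<theta> (monom 1 i) f"
  have coeff_F: "coeff F k = (if i \<le> k then (\<theta> ^^ i) (coeff f (k - i)) else 0)" for k
  proof -
    have "coeff F k = (\<Sum>j\<le>k. if j = i then (\<theta> ^^ i) (coeff f (k - i)) else 0)"
      unfolding F_def coeff_skew_mult [OF aut_comm_ring_hom] by (intro sum.cong) auto
    then show ?thesis
      by simp
  qed
  have nz: "coeff F (degree f + i) \<noteq> 0"
    using assms(2) by (simp add: coeff_F funpow_aut_eq_0_iff)
  have deg: "degree F = degree f + i"
  proof (rule antisym)
    show "degree F \<le> degree f + i"
      by (rule degree_le) (auto simp: coeff_F coeff_eq_0)
  qed (rule le_degree [OF nz])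
  then have act: "skew_act \<theta> n (monom 1 i) f = F"
    unfolding skew_act_def F_def [symmetric] using assms(4)
    by (intro residue_Rn [OF aut_comm_ring_hom assms(1)]) (simp add: Rn_def)
  show "skew_act \<theta> n (monom 1 i) f \<noteq> 0" "degree (skew_act \<theta> n (monom 1 i) f) = degree f + i"
    unfolding act using nz deg by auto
  show "fst_poly (skew_act \<theta> n (monom 1 i) f) = 0"
    unfolding act F_def fst_poly_skew_mult assms(3) by simp
qed

text \<open>The common form of all three parts: \<open>g\<close> generates the image of
  \<open>C\<close> modulo u, and \<open>h\<close> lifts it to \<open>C\<close>. The congruence in
  place of equality lets \<open>g\<close> be \<open>x^n - 1\<close> itself, with \<open>h\<close>
  equal to 0.\<close>

lemma skew_cyclic_code_echelon_system:
  assumes n: "n \<ge> 1" and code: "skew_cyclic_code \<theta> n C"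
    and a: "a \<in> C" "a \<noteq> 0" "fst_poly a = 0" "degree a = t"
    and a_min: "\<And>f. u_poly f \<in> C \<Longrightarrow> f \<noteq> 0 \<Longrightarrow> t \<le> degree f"
    and g: "g \<noteq> 0" "degree g = r" "t \<le> r" "r \<le> n"
    and g_dvd: "\<And>f. f \<in> C \<Longrightarrow> g dvd fst_poly f"
    and h: "h \<in> C" "xn1 n dvd fst_poly h - g"
  shows "echelon_system C (\<lambda>j. skew_act \<theta> n (monom 1 j) a) (\<lambda>i. skew_act \<theta> n (monom 1 i) h)
    t (r - t) (n - r)"
proof
  fix j
  assume "j < r - t"
  with g a show "skew_act \<theta> n (monom 1 j) a \<noteq> 0" "fst_poly (skew_act \<theta> n (monom 1 j) a) = 0"
    "degree (skew_act \<theta> n (monom 1 j) a) = t + j"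
    using skew_act_monom_torsion [OF n a(2,3), of j] by auto
next
  fix i
  assume "i < n - r"
  with g have *: "fst_poly (skew_act \<theta> n (monom 1 i) h) = monom 1 i * g"
    by (intro fst_poly_skew_act_monom [OF n h(2)]) auto
  show "fst_poly (skew_act \<theta> n (monom 1 i) h) \<noteq> 0"
    unfolding * using g(1) by simp
  show "degree (fst_poly (skew_act \<theta> n (monom 1 i) h)) = t + (r - t) + i"
    unfolding * using g by (simp add: degree_mult_eq degree_monom_eq)
next
  fix f
  assume "f \<in> C"
  then show "degree f < t + (r - t) + (n - r)"
    using code g by (auto simp: skew_cyclic_code_def Rn_def)
  show "t + (r - t) \<le> degree (fst_poly f)" if "fst_poly f \<noteq> 0"
    using dvd_imp_degree_le [OF g_dvd [OF \<open>f \<in> C\<close>] that] g by simp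
qed (use code a_min a(1) h(1) skew_cyclic_code_subspace [OF aut_comm_ring_hom n code] in
    \<open>auto simp: skew_cyclic_code_def\<close>)

end

text \<open>Elements of the prime field are sums of ones and hence fixed. The u-part squares to 0,
  so the first component of its image squares to 0 in a field and vanishes.\<close>

lemma fst_part_ring_hom:
  fixes \<theta> :: "'p::prime_card mod_ring dual \<Rightarrow> 'p mod_ring dual"
  assumes "comm_ring_hom \<theta>"
  shows "fst_part (\<theta> x) = fst_part x"
proof -
  interpret comm_ring_hom \<theta> by fact
  obtain k where k: "fst_part x = of_nat k"
    using surj_of_nat_mod_ring by blast
  define v where "v = Dual 0 (snd_part x)"
  have "\<theta> v * \<theta> v = \<theta> (v * v)"
    by (simp add: hom_mult)
  also have "v * v = 0"
    by (simp add: v_def dual_ring_defs)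
  finally have "fst_part (\<theta> v) * fst_part (\<theta> v) = 0"
    by (metis fst_part_simps(1,6) hom_zero)
  have "x = of_nat k + v"
  proof -
    have "of_nat k = Dual (of_nat k :: 'p mod_ring) 0"
      by (induction k) (simp_all add: dual_ring_defs)
    then show ?thesis
      by (cases x) (use k in \<open>simp add: v_def dual_ring_defs\<close>)
  qed
  then have "\<theta> x = of_nat k + \<theta> v"
    by (metis hom_add hom_of_nat)
  then show ?thesis
    using \<open>fst_part (\<theta> v) * fst_part (\<theta> v) = 0\<close> by (simp add: k fst_part.hom_of_nat)
qed

theorem theorem19:
  fixes \<theta> :: "'p::prime_card mod_ring dual \<Rightarrow> 'p mod_ring dual"
    and e n :: nat
    and C :: "'p mod_ring dual poly set"
  assumes "odd CARD('p)"
    and "comm_ring_isom \<theta>" and "is_aut_order \<theta> e" and "e > 1"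
    and "n \<ge> 1"
    and "skew_cyclic_code \<theta> n C" and "C \<noteq> {0}"
  shows
    "(\<forall>(abar :: 'p mod_ring poly) (bbar :: 'p mod_ring poly) r.
        C = generated_code \<theta> n {u_poly abar} \<and>
        minimal_degree_in C (u_poly abar) \<and> degree (u_poly abar) = r \<and>
        xn1 n = bbar * abar \<longrightarrow>
        minimal_generating_set C ((\<lambda>i. skew_act \<theta> n (monom 1 i) (u_poly abar)) ` {..<n - r}) \<and>
        card C = CARD('p) ^ (n - r))
     \<and>
     (\<forall>g k r.
        C = generated_code \<theta> n {g} \<and>
        minimal_degree_in C g \<and> degree g = r \<and>
        xn1 n = skew_mult \<theta> k g \<longrightarrow>
        minimal_generating_set C ((\<lambda>i. skew_act \<theta> n (monom 1 i) g) ` {..<n - r}) \<and>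
        card C = (CARD('p) ^ 2) ^ (n - r))
     \<and>
     (\<forall>g g1 g2 a k h (p :: 'p mod_ring poly) abar bbar r t.
        h = residue \<theta> n (g + u_poly p) \<and> a = u_poly abar \<and>
        C = generated_code \<theta> n {h, a} \<and>
        minimal_degree_in C a \<and> degree a = t \<and> lead_coeff a \<noteq> 1 \<and>
        minimal_degree_monic_in C g \<and> degree g = r \<and>
        xn1 n = skew_mult \<theta> k g \<and>
        xn1 n = bbar * abar \<and>
        g = base_poly g1 + u_poly g2 \<and> abar dvd g1 \<and>
        skew_act \<theta> n k (residue \<theta> n (u_poly p)) \<in> generated_code \<theta> n {u_poly abar} \<longrightarrow>
        minimal_generating_set C
          ((\<lambda>i. skew_act \<theta> n (monom 1 i) h) ` {..<n - r} \<union>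
           (\<lambda>i. skew_act \<theta> n (monom 1 i) (u_poly abar)) ` {..<r - t}) \<and>
        card C = (CARD('p) ^ 2) ^ (n - r) * CARD('p) ^ (r - t))"
proof (intro conjI)
  note isom = \<open>comm_ring_isom \<theta>\<close> and n = \<open>n \<ge> 1\<close> and code = \<open>skew_cyclic_code \<theta> n C\<close>
  interpret \<theta>: comm_ring_isom \<theta> by fact
  have hom: "comm_ring_hom \<theta>" by unfold_locales
  note fst_aut = fst_part_ring_hom [OF hom]
  note echelon = skew_cyclic_code_echelon_system [OF isom fst_aut n code]
  note dvd_fst = dvd_fst_poly_generated_code [OF isom fst_aut n]
  have Rn: "f \<in> Rn n" if "f \<in> C" for f
    using code that by (auto simp: skew_cyclic_code_def)
  then have less_n: "degree f < n" if "f \<in> C" for f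
    using that by (auto simp: Rn_def)
  have smult_C: "smult c f \<in> C" if "f \<in> C" for c f
    using skew_cyclic_code_subspace [OF hom n code] that
    by (simp add: Modules.module.subspace_def [OF module_smult])
  have fst_xn1: "fst_poly (xn1 n :: 'p mod_ring dual poly) = xn1 n"
    by (rule fst_poly_xn1 [OF isom fst_aut])
  have xn1_nz: "(xn1 n :: 'p mod_ring poly) \<noteq> 0"
    using degree_xn1 [OF n, where ?'a = "'p mod_ring"] n by (metis degree_0 not_one_le_zero)
  have min_deg: "f \<in> C" "f \<noteq> 0" "\<And>h. h \<in> C \<Longrightarrow> h \<noteq> 0 \<Longrightarrow> degree f \<le> degree h"
    if "minimal_degree_in C f" for f
    using that by (auto simp: minimal_degree_in_def is_arg_min_def not_less)
  have min_deg_u: "degree f \<le> degree h"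
    if "minimal_degree_in C f" "u_poly h \<in> C" "h \<noteq> 0" for f h
    using min_deg(3) [OF that(1,2)] that(3) by simp

  \<comment> \<open>Codes consisting of u-multiples\<close>
  show "\<forall>(abar :: 'p mod_ring poly) (bbar :: 'p mod_ring poly) r.
        C = generated_code \<theta> n {u_poly abar} \<and>
        minimal_degree_in C (u_poly abar) \<and> degree (u_poly abar) = r \<and>
        xn1 n = bbar * abar \<longrightarrow>
        minimal_generating_set C ((\<lambda>i. skew_act \<theta> n (monom 1 i) (u_poly abar)) ` {..<n - r}) \<and>
        card C = CARD('p) ^ (n - r)"
  proof (intro allI impI, elim conjE)
    fix abar bbar :: "'p mod_ring poly" and r
    assume C: "C = generated_code \<theta> n {u_poly abar}" and "minimal_degree_in C (u_poly abar)"
      and r: "degree (u_poly abar) = r"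
    note a = min_deg [OF this(2)] and a_min = min_deg_u [OF this(2)]
    \<comment> \<open>The generator reduces to 0 modulo u, which \<open>x^n - 1\<close>
      divides.\<close>
    have "xn1 n dvd fst_poly f" if "f \<in> C" for f
    proof (rule dvd_fst)
      show "f \<in> generated_code \<theta> n {u_poly abar}"
        using that C by blast
    qed (use Rn [OF a(1)] in auto)
    \<comment> \<open>\<open>C\<close> vanishes modulo \<open>u\<close>, which fits the general case with \<open>x\<^sup>n - 1\<close> in the role of \<open>g\<close>.\<close>
    moreover have "xn1 n dvd fst_poly 0 - (xn1 n :: 'p mod_ring poly)"
      by (simp del: minus_diff_eq)
    ultimately have "echelon_system C (\<lambda>j. skew_act \<theta> n (monom 1 j) (u_poly abar))
        (\<lambda>i. skew_act \<theta> n (monom 1 i) 0) r (n - r) (n - n)"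
      using a(1,2) a_min r code less_n [OF a(1)] xn1_nz degree_xn1 [OF n, where ?'a = "'p mod_ring"]
      by (intro echelon [where g = "xn1 n"]) (auto simp: skew_cyclic_code_def)
    from echelon_system.minimal_generating_set [OF this] card_echelon_system [OF this]
    show "minimal_generating_set C ((\<lambda>i. skew_act \<theta> n (monom 1 i) (u_poly abar)) ` {..<n - r}) \<and>
        card C = CARD('p) ^ (n - r)"
      by simp
  qed

  \<comment> \<open>Codes with one generator that divides \<open>x^n - 1\<close> on the
    right\<close>
  show "\<forall>g k r.
        C = generated_code \<theta> n {g} \<and>
        minimal_degree_in C g \<and> degree g = r \<and>
        xn1 n = skew_mult \<theta> k g \<longrightarrow>
        minimal_generating_set C ((\<lambda>i. skew_act \<theta> n (monom 1 i) g) ` {..<n - r}) \<and>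
        card C = (CARD('p) ^ 2) ^ (n - r)"
  proof (intro allI impI, elim conjE)
    fix g k r
    assume C: "C = generated_code \<theta> n {g}" and "minimal_degree_in C g"
      and r: "degree g = r" and k: "xn1 n = skew_mult \<theta> k g"
    note g = min_deg [OF this(2)] and g_min = min_deg_u [OF this(2)]
    \<comment> \<open>Reducing the skew factorisation modulo u gives an ordinary one over the field,
      so the reduction of \<open>g\<close> is a nonzero divisor polynomial of
      \<open>x^n - 1\<close>.\<close>
    have xn1: "xn1 n = fst_poly k * fst_poly g"
      using fst_xn1 unfolding k fst_poly_skew_mult [OF isom fst_aut] by simp
    then have fst_g: "fst_poly g \<noteq> 0"
      using xn1_nz by auto
    \<comment> \<open>If the leading coefficient of \<open>g\<close> were a multiple of \<open>u\<close>, then \<open>u g\<close> would be a nonzero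
      element of smaller degree.\<close>
    have "smult u_elem g \<in> C" "smult u_elem g \<noteq> 0"
      using smult_C [OF g(1)] fst_g by (simp_all add: smult_u_elem_eq_0_iff)
    then have "r \<le> degree (fst_poly g)"
      using g(3) [of "smult u_elem g"] r by (simp add: degree_smult_u_elem)
    then have deg: "degree (fst_poly g) = r"
      using degree_map_poly_le [of fst_part g] r by simp
    have "fst_poly g dvd fst_poly f" if "f \<in> C" for f
    proof (rule dvd_fst)
      show "f \<in> generated_code \<theta> n {g}"
        using that C by blast
    qed (use Rn [OF g(1)] xn1 in auto)
    \<comment> \<open>Here u times \<open>g\<close> serves as the u-multiple of minimal degree; its
      family of shifts is empty because \<open>r - r\<close> is 0.\<close>
    then have "echelon_system C (\<lambda>j. skew_act \<theta> n (monom 1 j) (smult u_elem g))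
        (\<lambda>i. skew_act \<theta> n (monom 1 i) g) r (r - r) (n - r)"
      using g(1) g_min r deg fst_g less_n [OF g(1)]
        \<open>smult u_elem g \<in> C\<close> \<open>smult u_elem g \<noteq> 0\<close>
      by (intro echelon [where g = "fst_poly g"]) (auto simp: degree_smult_u_elem fst_poly_smult)
    from echelon_system.minimal_generating_set [OF this] card_echelon_system [OF this]
    show "minimal_generating_set C ((\<lambda>i. skew_act \<theta> n (monom 1 i) g) ` {..<n - r}) \<and>
        card C = (CARD('p) ^ 2) ^ (n - r)"
      by simp
  qed

  \<comment> \<open>Codes with two generators, one of them a u-multiple\<close>
  show "\<forall>g g1 g2 a k h (p :: 'p mod_ring poly) abar bbar r t.
        h = residue \<theta> n (g + u_poly p) \<and> a = u_poly abar \<and>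
        C = generated_code \<theta> n {h, a} \<and>
        minimal_degree_in C a \<and> degree a = t \<and> lead_coeff a \<noteq> 1 \<and>
        minimal_degree_monic_in C g \<and> degree g = r \<and>
        xn1 n = skew_mult \<theta> k g \<and>
        xn1 n = bbar * abar \<and>
        g = base_poly g1 + u_poly g2 \<and> abar dvd g1 \<and>
        skew_act \<theta> n k (residue \<theta> n (u_poly p)) \<in> generated_code \<theta> n {u_poly abar} \<longrightarrow>
        minimal_generating_set C
          ((\<lambda>i. skew_act \<theta> n (monom 1 i) h) ` {..<n - r} \<union>
           (\<lambda>i. skew_act \<theta> n (monom 1 i) (u_poly abar)) ` {..<r - t}) \<and>
        card C = (CARD('p) ^ 2) ^ (n - r) * CARD('p) ^ (r - t)"
  proof (intro allI impI, elim conjE)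
    fix g a k h and g1 g2 p abar bbar :: "'p mod_ring poly" and r t
    assume h: "h = residue \<theta> n (g + u_poly p)" and a_eq: "a = u_poly abar"
      and C: "C = generated_code \<theta> n {h, a}" and "minimal_degree_in C a"
      and t: "degree a = t" and g_min: "minimal_degree_monic_in C g" and r: "degree g = r"
      and k: "xn1 n = skew_mult \<theta> k g"
    note a = min_deg [OF this(4)] and a_min = min_deg_u [OF this(4)]
    have g: "g \<in> C" "lead_coeff g = 1"
      using g_min by (auto simp: minimal_degree_monic_in_def is_arg_min_def)
    have xn1: "xn1 n = fst_poly k * fst_poly g"
      using fst_xn1 unfolding k fst_poly_skew_mult [OF isom fst_aut] by simp
    then have fst_g: "fst_poly g \<noteq> 0"
      using xn1_nz by auto
    \<comment> \<open>As \<open>g\<close> is monic, its leading term survives reduction modulo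
      u.\<close>
    have "coeff (fst_poly g) r \<noteq> 0"
      using g(2) r by simp
    then have deg: "degree (fst_poly g) = r"
      using degree_map_poly_le [of fst_part g] r le_degree by (metis antisym)
    have "h \<in> C"
      unfolding C by (rule hull_inc) simp
    \<comment> \<open>The summand with \<open>p\<close> vanishes modulo u, so \<open>h\<close> and
      \<open>g\<close> have congruent reductions.\<close>
    have "xn1 n dvd fst_poly (g + u_poly p) - fst_poly h"
      unfolding h by (rule xn1_dvd_fst_poly_residue [OF isom fst_aut n])
    then have h_dvd: "xn1 n dvd fst_poly h - fst_poly g"
      by (simp add: fst_poly.hom_add dvd_diff_commute)
    have "fst_poly g dvd fst_poly h - fst_poly g"
      using h_dvd xn1 by (metis dvd_trans dvd_triv_right)
    then have "fst_poly g dvd fst_poly h"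
      by (metis diff_add_cancel dvd_add dvd_refl)
    have "fst_poly g dvd fst_poly f" if "f \<in> C" for f
    proof (rule dvd_fst)
      show "f \<in> generated_code \<theta> n {h, a}"
        using that C by blast
    qed (use Rn [OF a(1)] Rn [OF \<open>h \<in> C\<close>] xn1 a_eq \<open>fst_poly g dvd fst_poly h\<close> in auto)
    \<comment> \<open>u times \<open>g\<close> is a nonzero element of \<open>C\<close> of degree
      \<open>r\<close>, which the minimality of \<open>a\<close> bounds from below.\<close>
    moreover have "t \<le> r"
      using a(3) [OF smult_C [OF g(1), of u_elem]] fst_g t deg
      by (simp add: smult_u_elem_eq_0_iff degree_smult_u_elem)
    ultimately have "echelon_system C (\<lambda>j. skew_act \<theta> n (monom 1 j) a)
        (\<lambda>i. skew_act \<theta> n (monom 1 i) h) t (r - t) (n - r)"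
      using a(1,2) a_min a_eq t r deg fst_g less_n [OF g(1)]
        \<open>h \<in> C\<close> h_dvd
      by (intro echelon [where g = "fst_poly g"]) auto
    from echelon_system.minimal_generating_set [OF this] card_echelon_system [OF this]
    show "minimal_generating_set C
          ((\<lambda>i. skew_act \<theta> n (monom 1 i) h) ` {..<n - r} \<union>
           (\<lambda>i. skew_act \<theta> n (monom 1 i) (u_poly abar)) ` {..<r - t}) \<and>
        card C = (CARD('p) ^ 2) ^ (n - r) * CARD('p) ^ (r - t)"
      unfolding a_eq by simp
  qed
qed

end
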